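(* Let $\{a_i\}_{i<\omega}$ be the partition of $\omega$ into consecutive intervals with $|a_i|=i+1$, and let $\mathcal{ED}_{\mathrm{fin}}=\{x\subseteq\omega : \exists_{m<\omega}\forall_{i<\omega}\ |x\cap a_i|\leq m\}$. Then $\mathfrak{b}(\mathcal{ED}_{\mathrm{fin}})=\aleph_1$.
   Context: For an ideal $\mathcal{I}$ on $\omega$ (containing all finite sets, not containing $\omega$) and $A,B\subseteq\omega$ write $A\subseteq_{\mathcal{I}}B$ iff $A\smallsetminus B\in\mathcal{I}$. A pair $\langle\mathcal{A},\mathcal{B}\rangle$ of families of subsets of $\omega$ is $\mathcal{I}$-orthogonal if $A\cap B\in\mathcal{I}$ for all $A\in\mathcal{A},B\in\mathcal{B}$. A set $C\subseteq\omega$ separates it if $A\cap C\in\mathcal{I}$ for all $A\in\mathcal{A}$ and $B\subseteq_{\mathcal{I}}C$ for all $B\in\mathcal{B}$. An $\mathcal{I}$-gap is an $\mathcal{I}$-orthogonal pair that no subset of $\omega$ separates. The Rothberger number $\mathfrak{b}(\mathcal{I})$ is the least cardinal $\lambda$ such that there is an $\mathcal{I}$-gap $\langle\mathcal{A},\mathcal{B}\rangle$ with $|\mathcal{A}|=\aleph_0$ and $|\mathcal{B}|=\lambda$. *)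

theory Defs
  imports Complex_Main
begin

unbundle cardinal_syntax

definition ideal_on_omega :: "nat set set \<Rightarrow> bool" where
  "ideal_on_omega I \<longleftrightarrow>
     (\<forall>x. finite x \<longrightarrow> x \<in> I) \<and> UNIV \<notin> I \<and>
     (\<forall>x\<in>I. \<forall>y. y \<subseteq> x \<longrightarrow> y \<in> I) \<and> (\<forall>x\<in>I. \<forall>y\<in>I. x \<union> y \<in> I)"

definition subseteq_mod :: "nat set set \<Rightarrow> nat set \<Rightarrow> nat set \<Rightarrow> bool" where
  "subseteq_mod I A B \<longleftrightarrow> A - B \<in> I"

definition orthogonal_mod :: "nat set set \<Rightarrow> nat set set \<Rightarrow> nat set set \<Rightarrow> bool" where
  "orthogonal_mod I \<A> \<B> \<longleftrightarrow> (\<forall>A\<in>\<A>. \<forall>B\<in>\<B>. A \<inter> B \<in> I)"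

definition separates_mod :: "nat set set \<Rightarrow> nat set \<Rightarrow> nat set set \<Rightarrow> nat set set \<Rightarrow> bool" where
  "separates_mod I C \<A> \<B> \<longleftrightarrow> (\<forall>A\<in>\<A>. A \<inter> C \<in> I) \<and> (\<forall>B\<in>\<B>. subseteq_mod I B C)"

definition gap_mod :: "nat set set \<Rightarrow> nat set set \<Rightarrow> nat set set \<Rightarrow> bool" where
  "gap_mod I \<A> \<B> \<longleftrightarrow> orthogonal_mod I \<A> \<B> \<and> \<not> (\<exists>C. separates_mod I C \<A> \<B>)"

text \<open>
  Cardinals are represented, as in the library, by cardinal orders, with equality of cardinals
  being order isomorphism; hence the Rothberger number \<open>\<bb>(I)\<close> is introduced by the relation
  ``\<open>r\<close> is the least cardinal \<open>\<lambda>\<close> such that there is a gap \<open>(\<A>, \<B>)\<close> with \<open>\<A>\<close> of size aleph-zero and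
  \<open>\<B>\<close> of size \<open>\<lambda>\<close>'', which determines \<open>r\<close> up to that equality.
\<close>
definition is_rothberger_number :: "nat set set \<Rightarrow> 'c rel \<Rightarrow> bool" where
  "is_rothberger_number I r \<longleftrightarrow>
     Card_order r \<and>
     (\<exists>\<A> \<B>. gap_mod I \<A> \<B> \<and> |\<A>| =o natLeq \<and> |\<B>| =o r) \<and>
     (\<forall>\<A> \<B>. gap_mod I \<A> \<B> \<and> |\<A>| =o natLeq \<longrightarrow> r \<le>o |\<B>| )"

definition ED_block :: "nat \<Rightarrow> nat set" where
  "ED_block i = {(\<Sum>j<i. j + 1) ..< (\<Sum>j<Suc i. j + 1)}"

definition ED_fin :: "nat set set" where
  "ED_fin = {x. \<exists>m. \<forall>i. card (x \<inter> ED_block i) \<le> m}"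

abbreviation aleph_one :: "nat set rel" where
  "aleph_one \<equiv> cardSuc natLeq"

lemma finite_ED_block [simp]: "finite (ED_block i)"
  by (simp add: ED_block_def)

lemma card_ED_block: "card (ED_block i) = i + 1"
  by (simp add: ED_block_def)

lemma ED_block_disjoint:
  assumes "i \<noteq> k"
  shows "ED_block i \<inter> ED_block k = {}"
proof -
  have mono: "(\<Sum>j<a. j + 1) \<le> (\<Sum>j<b. j + 1)" if "a \<le> b" for a b :: nat
    using that by (intro sum_mono2) auto
  have "ED_block a \<inter> ED_block b = {}" if "a < b" for a b
    using mono[of "Suc a" b] that by (auto simp: ED_block_def)
  then show ?thesis
    using assms by (metis Int_commute nat_neq_iff)
qed

lemma UN_ED_block: "(\<Union>i. ED_block i) = UNIV"
proof -
  have "{..<(\<Sum>j<n. j + 1)} \<subseteq> (\<Union>i. ED_block i)" for n :: nat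
  proof (induction n)
    case (Suc n)
    have "{..<(\<Sum>j<Suc n. j + 1)} = {..<(\<Sum>j<n. j + 1)} \<union> ED_block n"
      by (auto simp: ED_block_def)
    then show ?case using Suc by auto
  qed simp
  moreover have "x < (\<Sum>j<Suc x. j + 1)" for x :: nat
    by (induction x) auto
  ultimately show ?thesis by blast
qed

lemma ideal_ED_fin: "ideal_on_omega ED_fin"
  unfolding ideal_on_omega_def
proof (intro conjI allI impI ballI)
  fix x :: "nat set" assume "finite x"
  then have "card (x \<inter> ED_block i) \<le> card x" for i
    by (intro card_mono) auto
  then show "x \<in> ED_fin" by (auto simp: ED_fin_def)
next
  show "UNIV \<notin> ED_fin"
  proof
    assume "UNIV \<in> ED_fin"
    then obtain m where "\<forall>i. Suc i \<le> m" by (auto simp: ED_fin_def card_ED_block)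
    then have "Suc m \<le> m" by (rule spec)
    then show False by simp
  qed
next
  fix x y assume "x \<in> ED_fin" "y \<subseteq> x"
  then obtain m where m: "card (x \<inter> ED_block i) \<le> m" for i by (auto simp: ED_fin_def)
  have "card (y \<inter> ED_block i) \<le> card (x \<inter> ED_block i)" for i
    using \<open>y \<subseteq> x\<close> by (intro card_mono) auto
  then have "card (y \<inter> ED_block i) \<le> m" for i using m[of i] order_trans by blast
  then show "y \<in> ED_fin" by (auto simp: ED_fin_def)
next
  fix x y assume "x \<in> ED_fin" "y \<in> ED_fin"
  then obtain m n where mn: "card (x \<inter> ED_block i) \<le> m" "card (y \<inter> ED_block i) \<le> n" for i
    by (auto simp: ED_fin_def)
  have "card ((x \<union> y) \<inter> ED_block i) \<le> m + n" for i
    using card_Un_le[of "x \<inter> ED_block i" "y \<inter> ED_block i"] mn[of i]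
    by (simp add: Int_Un_distrib2)
  then show "x \<union> y \<in> ED_fin" by (auto simp: ED_fin_def)
qed

end

theory Submission
  imports Defs "HOL-Library.Countable_Set_Type"
begin

text \<open>
  A countable orthogonal pair \<open>(A\<^sub>n, B\<^sub>n)\<close> is separated by \<open>\<Union>n. B\<^sub>n - (A\<^sub>0 \<union> \<dots> \<union> A\<^sub>n)\<close>, for every
  ideal. For a gap of size aleph-one, place a copy of \<open>{0..k} \<times> Pow {..<k}\<close> inside one block for
  each \<open>k\<close>; let \<open>A\<^sub>n\<close> be the union of the \<open>n\<close>-th rows and let \<open>B\<^sub>x\<close>, for \<open>x \<subseteq> \<omega>\<close>, be the union
  of the columns \<open>x \<inter> {..<k}\<close>. If \<open>C\<close> meets the rows \<open>A\<^sub>0, \<dots>, A\<^sub>m\<close> in sets with at most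
  \<open>g 0, \<dots>, g m\<close> points per block, then among more than \<open>g 0 + \<dots> + g m\<close> sets \<open>x\<close> there is one whose
  column avoids \<open>C\<close> in all of these rows, in any block far enough out to tell the sets \<open>x\<close> apart.
  Hence only finitely many \<open>x\<close> can have \<open>B\<^sub>x - C\<close> with at most \<open>m\<close> points per block, and \<open>C\<close>
  separates \<open>(A\<^sub>n)\<close> from only countably many \<open>B\<^sub>x\<close>.
\<close>

lemma ideal_on_omega_subset: "ideal_on_omega I \<Longrightarrow> x \<in> I \<Longrightarrow> y \<subseteq> x \<Longrightarrow> y \<in> I"
  unfolding ideal_on_omega_def by blast

lemma ideal_on_omega_UN:
  assumes "ideal_on_omega I" "finite J" "\<And>j. j \<in> J \<Longrightarrow> f j \<in> I"
  shows "(\<Union>j\<in>J. f j) \<in> I"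
  using assms(2,3)
proof (induction J rule: finite_induct)
  case empty
  then show ?case using assms(1) by (simp add: ideal_on_omega_def)
next
  case (insert j J)
  then show ?case using assms(1) unfolding ideal_on_omega_def by simp
qed

lemma countable_orthogonal_separated:
  assumes I: "ideal_on_omega I" and orth: "orthogonal_mod I \<A> \<B>"
    and "countable \<A>" "countable \<B>"
  shows "\<exists>C. separates_mod I C \<A> \<B>"
\<comment> \<open>A nonempty countable family is the range of its enumeration; repetitions, as for
  finite families, do no harm.\<close>
proof (cases "\<A> = {} \<or> \<B> = {}")
  case True
  have "{} \<in> I" using I by (simp add: ideal_on_omega_def)
  then have "separates_mod I UNIV \<A> \<B>" if "\<A> = {}"
    using that by (simp add: separates_mod_def subseteq_mod_def)
  moreover have "separates_mod I {} \<A> \<B>" if "\<B> = {}"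
    using that \<open>{} \<in> I\<close> by (simp add: separates_mod_def)
  ultimately show ?thesis using True by blast
next
  case False
  define a where "a = from_nat_into \<A>"
  define b where "b = from_nat_into \<B>"
  have ra: "range a = \<A>" and rb: "range b = \<B>"
    using False assms(3,4) by (auto simp: a_def b_def range_from_nat_into)
  have ab: "a k \<inter> b n \<in> I" for k n
    using orth ra rb unfolding orthogonal_mod_def by blast
  \<comment> \<open>The piece cut from \<open>b n\<close> avoids \<open>a k\<close> once
    \<open>k \<le> n\<close>, so \<open>a k\<close> meets \<open>C\<close> only inside
    \<open>b n\<close> with \<open>n < k\<close>. What \<open>C\<close> misses of \<open>b n\<close>
    lies in \<open>a 0\<close>, ..., \<open>a n\<close>. Both are covered by finite unions of sets
    \<open>a k \<inter> b n\<close>.\<close>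
  define C where "C = (\<Union>n. b n - (\<Union>k\<le>n. a k))"
  have "a k \<inter> C \<in> I" for k
  proof -
    have "(\<Union>n\<in>{..<k}. a k \<inter> b n) \<in> I"
      using ab by (intro ideal_on_omega_UN[OF I]) auto
    moreover have "a k \<inter> C \<subseteq> (\<Union>n\<in>{..<k}. a k \<inter> b n)"
    proof
      fix x assume "x \<in> a k \<inter> C"
      then obtain n where "x \<in> a k" "x \<in> b n" "\<forall>k\<le>n. x \<notin> a k" unfolding C_def by auto
      then show "x \<in> (\<Union>n\<in>{..<k}. a k \<inter> b n)" using not_le by blast
    qed
    ultimately show ?thesis by (rule ideal_on_omega_subset[OF I])
  qed
  moreover have "b n - C \<in> I" for n
  proof -
    have "(\<Union>k\<in>{..n}. a k \<inter> b n) \<in> I"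
      using ab by (intro ideal_on_omega_UN[OF I]) auto
    moreover have "b n - C \<subseteq> (\<Union>k\<in>{..n}. a k \<inter> b n)"
      unfolding C_def by auto
    ultimately show ?thesis by (rule ideal_on_omega_subset[OF I])
  qed
  ultimately have "separates_mod I C \<A> \<B>"
    unfolding separates_mod_def subseteq_mod_def ra[symmetric] rb[symmetric] by blast
  then show ?thesis ..
qed

lemma aleph_one_le_iff_uncountable: "aleph_one \<le>o |X| \<longleftrightarrow> \<not> countable X"
proof -
  have "aleph_one \<le>o |X| \<longleftrightarrow> natLeq <o |X|"
    by (rule cardSuc_ordLess_ordLeq[symmetric]) (auto simp: natLeq_Card_order card_of_Card_order)
  also have "\<dots> \<longleftrightarrow> \<not> |X| \<le>o natLeq"
    using natLeq_Well_order card_of_Well_order not_ordLess_iff_ordLeq by blast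
  also have "|X| \<le>o natLeq \<longleftrightarrow> countable X"
    by (simp add: countable_card_le_natLeq)
  finally show ?thesis .
qed

text \<open>Two distinct sets differ at some \<open>j\<close> and hence have distinct traces for all
  \<open>k > j\<close>; a finite family has only finitely many pairs.\<close>

lemma eventually_inj_on_initial_segments:
  fixes F :: "nat set set"
  assumes "finite F"
  shows "\<forall>\<^sub>F k in sequentially. inj_on (\<lambda>x. x \<inter> {..<k}) F"
proof -
  have "\<forall>\<^sub>F k in sequentially. x \<inter> {..<k} = y \<inter> {..<k} \<longrightarrow> x = y" for x y :: "nat set"
  proof (cases "x = y")
    case False
    then obtain j where "j \<in> x \<longleftrightarrow> j \<notin> y" by blast
    then have "x \<inter> {..<k} \<noteq> y \<inter> {..<k}" if "k \<ge> Suc j" for k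
      using that by (metis IntD1 IntI Suc_le_eq lessThan_iff)
    then show ?thesis unfolding eventually_sequentially by blast
  qed simp
  then have "\<forall>\<^sub>F k in sequentially. \<forall>x\<in>F. \<forall>y\<in>F. x \<inter> {..<k} = y \<inter> {..<k} \<longrightarrow> x = y"
    using assms by (intro eventually_ball_finite ballI)
  then show ?thesis by (simp add: inj_on_def)
qed

text \<open>The index makes room for the (k+1) * 2^k grid points and strictly increases with
  \<open>k\<close>, so distinct grids occupy disjoint blocks.\<close>

definition grid_block :: "nat \<Rightarrow> nat set" where
  "grid_block k = ED_block (Suc k * 2 ^ k)"

lemma grid_block_disjoint:
  assumes "j \<noteq> k"
  shows "grid_block j \<inter> grid_block k = {}"
proof -
  have "strict_mono (\<lambda>k::nat. Suc k * 2 ^ k)"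
    by (simp add: strict_mono_Suc_iff)
  then have "Suc j * 2 ^ j \<noteq> Suc k * 2 ^ k"
    using assms strict_mono_eq by blast
  then show ?thesis unfolding grid_block_def by (rule ED_block_disjoint)
qed

lemma ex_grid_embedding:
  "\<exists>e :: nat \<Rightarrow> nat \<times> nat set \<Rightarrow> nat.
     \<forall>k. inj_on (e k) ({..k} \<times> Pow {..<k}) \<and> e k ` ({..k} \<times> Pow {..<k}) \<subseteq> grid_block k"
proof (intro choice allI)
  fix k
  have "card ({..k} \<times> Pow {..<k}) \<le> card (grid_block k)"
    by (simp add: card_cartesian_product card_Pow grid_block_def card_ED_block)
  then show "\<exists>e :: nat \<times> nat set \<Rightarrow> nat.
      inj_on e ({..k} \<times> Pow {..<k}) \<and> e ` ({..k} \<times> Pow {..<k}) \<subseteq> grid_block k"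
    using card_le_inj[of "{..k} \<times> Pow {..<k}" "grid_block k"] by (auto simp: grid_block_def)
qed

text \<open>Values off the grid are unconstrained, which is why later facts carry
  \<open>n \<le> k\<close> and \<open>s \<subseteq> {..<k}\<close>.\<close>

definition grid_embedding :: "nat \<Rightarrow> nat \<times> nat set \<Rightarrow> nat" where
  "grid_embedding = (SOME e. \<forall>k. inj_on (e k) ({..k} \<times> Pow {..<k}) \<and>
     e k ` ({..k} \<times> Pow {..<k}) \<subseteq> grid_block k)"

lemma
  shows inj_on_grid_embedding: "inj_on (grid_embedding k) ({..k} \<times> Pow {..<k})"
    and grid_embedding_in_block:
      "n \<le> k \<Longrightarrow> s \<subseteq> {..<k} \<Longrightarrow> grid_embedding k (n, s) \<in> grid_block k"
proof -
  have *: "inj_on (grid_embedding k) ({..k} \<times> Pow {..<k})"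
    "grid_embedding k ` ({..k} \<times> Pow {..<k}) \<subseteq> grid_block k"
    using someI_ex[OF ex_grid_embedding] unfolding grid_embedding_def[symmetric] by simp_all
  show "inj_on (grid_embedding k) ({..k} \<times> Pow {..<k})" by (rule *)
  show "grid_embedding k (n, s) \<in> grid_block k" if "n \<le> k" "s \<subseteq> {..<k}"
    using *(2) that by (simp add: image_subset_iff)
qed

lemma grid_embedding_eq_iff:
  assumes "n \<le> k" "s \<subseteq> {..<k}" "n' \<le> k'" "s' \<subseteq> {..<k'}"
  shows "grid_embedding k (n, s) = grid_embedding k' (n', s') \<longleftrightarrow> k = k' \<and> n = n' \<and> s = s'"
proof
  assume eq: "grid_embedding k (n, s) = grid_embedding k' (n', s')"
  then have "k = k'"
    using grid_embedding_in_block[OF assms(1,2)] grid_embedding_in_block[OF assms(3,4)]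
      grid_block_disjoint[of k k'] by auto
  then show "k = k' \<and> n = n' \<and> s = s'"
    using inj_onD[OF inj_on_grid_embedding, of k "(n, s)" "(n', s')"] eq assms by auto
qed simp

definition row :: "nat \<Rightarrow> nat set" where
  "row n = {grid_embedding k (n, s) | k s. n \<le> k \<and> s \<subseteq> {..<k}}"

definition column :: "nat set \<Rightarrow> nat set" where
  "column x = {grid_embedding k (n, x \<inter> {..<k}) | k n. n \<le> k}"

lemma inj_row: "inj row"
proof (rule injI)
  fix n m assume "row n = row m"
  moreover have "grid_embedding n (n, {}) \<in> row n" unfolding row_def by blast
  ultimately show "n = m" unfolding row_def by (auto simp: grid_embedding_eq_iff)
qed

lemma inj_column: "inj column"
proof (rule injI)
  fix x y assume eq: "column x = column y"
  have "x \<inter> {..<k} = y \<inter> {..<k}" for k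
  proof -
    \<comment> \<open>Row 0 is present in every block, so it reveals all traces of
      \<open>x\<close>.\<close>
    have "grid_embedding k (0, x \<inter> {..<k}) \<in> column x"
      unfolding column_def by blast
    then show ?thesis unfolding eq unfolding column_def by (auto simp: grid_embedding_eq_iff)
  qed
  then have "j \<in> x \<longleftrightarrow> j \<in> y" for j by (metis IntD1 IntI lessI lessThan_iff)
  then show "x = y" by blast
qed

text \<open>Within one grid a row and a column cross in at most one point, and an
  \<open>ED_block\<close> hosts at most one grid.\<close>

lemma row_Int_column_in_ED_fin: "row n \<inter> column x \<in> ED_fin"
proof -
  have "card (row n \<inter> column x \<inter> ED_block i) \<le> Suc 0" for i
  proof (subst card_le_Suc0_iff_eq, simp, intro ballI)
    fix p q assume p: "p \<in> row n \<inter> column x \<inter> ED_block i" and q: "q \<in> row n \<inter> column x \<inter> ED_block i"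
    have pt: "\<exists>k. n \<le> k \<and> r = grid_embedding k (n, x \<inter> {..<k})" if "r \<in> row n \<inter> column x" for r
      using that unfolding row_def column_def by (auto simp: grid_embedding_eq_iff)
    obtain k where k: "n \<le> k" "p = grid_embedding k (n, x \<inter> {..<k})" using pt p by blast
    obtain l where l: "n \<le> l" "q = grid_embedding l (n, x \<inter> {..<l})" using pt q by blast
    have "p \<in> grid_block k" "q \<in> grid_block l"
      using k l grid_embedding_in_block by auto
    then have "grid_block k = ED_block i" "grid_block l = ED_block i"
      using p q ED_block_disjoint unfolding grid_block_def by (metis IntD2 IntI empty_iff)+
    then have "k = l" using grid_block_disjoint[of k l] p by auto
    then show "p = q" using k l by simp
  qed
  then show ?thesis unfolding ED_fin_def by blast
qed

lemma finite_columns_bounded_off: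
  assumes rows: "\<And>n. row n \<inter> C \<in> ED_fin"
  shows "finite {x. \<forall>i. card ((column x - C) \<inter> ED_block i) \<le> m}" (is "finite ?X")
proof (rule ccontr)
  assume "infinite ?X"
  obtain g where g: "card (row n \<inter> C \<inter> ED_block i) \<le> g n" for n i
    using rows unfolding ED_fin_def mem_Collect_eq by metis
  \<comment> \<open>One element more than the sets of \<open>x\<close> whose column meets
    \<open>C\<close> in one of the rows 0, ..., \<open>m\<close> can cover.\<close>
  obtain F where F: "F \<subseteq> ?X" "finite F" "card F = Suc (\<Sum>n\<le>m. g n)"
    using infinite_arbitrarily_large[OF \<open>infinite ?X\<close>] by blast
  \<comment> \<open>Injectivity gives different elements of \<open>F\<close> different points in
    each row, and \<open>m \<le> k\<close> ensures that rows 0, ..., \<open>m\<close> reach block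
    \<open>k\<close>.\<close>
  have "\<forall>\<^sub>F k in sequentially. inj_on (\<lambda>x. x \<inter> {..<k}) F \<and> m \<le> k"
    using eventually_inj_on_initial_segments[OF F(2)] eventually_ge_at_top by (rule eventually_conj)
  then obtain k where inj: "inj_on (\<lambda>x. x \<inter> {..<k}) F" and "m \<le> k"
    using eventually_happens' sequentially_bot by blast
  define pt where "pt n x = grid_embedding k (n, x \<inter> {..<k})" for n x
  have pt_block: "pt n x \<in> grid_block k" if "n \<le> m" for n x
    using that \<open>m \<le> k\<close> grid_embedding_in_block by (simp add: pt_def)
  have "card {x \<in> F. pt n x \<in> C} \<le> g n" if "n \<le> m" for n
  proof -
    have "inj_on (pt n) {x \<in> F. pt n x \<in> C}"
      using inj that \<open>m \<le> k\<close> by (auto simp: inj_on_def pt_def grid_embedding_eq_iff)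
    moreover have "pt n x \<in> row n" for x
      using order_trans[OF that \<open>m \<le> k\<close>] unfolding pt_def row_def by blast
    then have "pt n ` {x \<in> F. pt n x \<in> C} \<subseteq> row n \<inter> C \<inter> grid_block k"
      using pt_block that by auto
    ultimately have "card {x \<in> F. pt n x \<in> C} \<le> card (row n \<inter> C \<inter> grid_block k)"
      by (intro card_inj_on_le) (auto simp: grid_block_def)
    also have "\<dots> \<le> g n" unfolding grid_block_def by (rule g)
    finally show ?thesis .
  qed
  then have "card (\<Union>n\<in>{..m}. {x \<in> F. pt n x \<in> C}) \<le> (\<Sum>n\<le>m. g n)"
    by (intro order_trans[OF card_UN_le] sum_mono) auto
  then have "card (\<Union>n\<in>{..m}. {x \<in> F. pt n x \<in> C}) < card F"
    using F(3) by simp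
  then have "\<not> F \<subseteq> (\<Union>n\<in>{..m}. {x \<in> F. pt n x \<in> C})"
    using F(2) card_mono[of "\<Union>n\<in>{..m}. {x \<in> F. pt n x \<in> C}" F] by fastforce
  then obtain x where x: "x \<in> F" "\<And>n. n \<le> m \<Longrightarrow> pt n x \<notin> C" by auto
  \<comment> \<open>Rows 0, ..., \<open>m\<close> supply m + 1 points of the column outside
    \<open>C\<close> in a single block, one too many.\<close>
  have "(\<lambda>n. pt n x) ` {..m} \<subseteq> (column x - C) \<inter> grid_block k"
    using x(2) pt_block \<open>m \<le> k\<close> by (fastforce simp: pt_def column_def)
  moreover have "inj_on (\<lambda>n. pt n x) {..m}"
    using \<open>m \<le> k\<close> by (auto simp: inj_on_def pt_def grid_embedding_eq_iff)
  ultimately have "card {..m} \<le> card ((column x - C) \<inter> grid_block k)"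
    by (intro card_inj_on_le) (auto simp: grid_block_def)
  also have "\<dots> \<le> m" using x(1) F(1) unfolding grid_block_def by blast
  finally show False by simp
qed

text \<open>A separating set would make \<open>X\<close> a countable union of finite sets, one for
  each bound \<open>m\<close>.\<close>

lemma gap_rows_columns:
  assumes "\<not> countable X"
  shows "gap_mod ED_fin (range row) (column ` X)"
  unfolding gap_mod_def
proof (intro conjI notI)
  show "orthogonal_mod ED_fin (range row) (column ` X)"
    by (auto simp: orthogonal_mod_def row_Int_column_in_ED_fin)
next
  assume "\<exists>C. separates_mod ED_fin C (range row) (column ` X)"
  then obtain C where rows: "\<And>n. row n \<inter> C \<in> ED_fin"
    and columns: "\<And>x. x \<in> X \<Longrightarrow> column x - C \<in> ED_fin"
    unfolding separates_mod_def subseteq_mod_def by blast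
  have "X \<subseteq> (\<Union>m. {x. \<forall>i. card ((column x - C) \<inter> ED_block i) \<le> m})"
    using columns unfolding ED_fin_def by auto
  moreover have "countable \<dots>"
    using finite_columns_bounded_off[OF rows] by (auto intro: countable_finite)
  ultimately show False using assms countable_subset by blast
qed

theorem theorem3p1:
  shows "is_rothberger_number ED_fin aleph_one"
  unfolding is_rothberger_number_def
proof (intro conjI allI impI)
  show aleph: "Card_order aleph_one"
    by (rule cardSuc_Card_order[OF natLeq_Card_order])
  \<comment> \<open>The elements of \<open>Field aleph_one\<close> are themselves sets of naturals,
    so this field can serve as the index set of the columns.\<close>
  have X: "|Field aleph_one| =o aleph_one"
    by (rule card_of_Field_ordIso[OF aleph])
  then have "\<not> countable (Field aleph_one)"
    unfolding aleph_one_le_iff_uncountable[symmetric] by (metis ordIso_iff_ordLeq)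
  then have "gap_mod ED_fin (range row) (column ` Field aleph_one)"
    by (rule gap_rows_columns)
  moreover have "|range row| =o natLeq"
    using card_of_ordIsoI[OF inj_on_imp_bij_betw[OF inj_row]] card_of_nat
    by (rule ordIso_transitive[OF ordIso_symmetric])
  moreover have "|column ` Field aleph_one| =o aleph_one"
    using card_of_ordIsoI[OF inj_on_imp_bij_betw[OF inj_on_subset[OF inj_column subset_UNIV]]] X
    by (rule ordIso_transitive[OF ordIso_symmetric])
  ultimately show "\<exists>\<A> \<B>. gap_mod ED_fin \<A> \<B> \<and> |\<A>| =o natLeq \<and> |\<B>| =o aleph_one"
    by blast
next
  fix \<A> \<B> assume *: "gap_mod ED_fin \<A> \<B> \<and> |\<A>| =o natLeq"
  then have "countable \<A>"
    by (simp add: countable_card_le_natLeq ordIso_imp_ordLeq)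
  then have "\<not> countable \<B>"
    using * countable_orthogonal_separated[OF ideal_ED_fin] unfolding gap_mod_def by blast
  then show "aleph_one \<le>o |\<B>|"
    by (simp add: aleph_one_le_iff_uncountable)
qed

end
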